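(* Let $n$ be a positive integer. Every set $E\subset\mathbb{R}^n$ which is co-meager in a non-empty open set contains a compact set $K$ with $\dim_U K=n$.
   Context: A set $E\subset\mathbb{R}^n$ is co-meager in a set $U\subset\mathbb{R}^n$ if $U\setminus E$ is meager, i.e. a countable union of nowhere dense sets. $|E|$ denotes the diameter of a set $E$. $\mathcal{D}$ is the family of all sets $D\subset(0,\infty)$ with $\inf D=0$ that are open in the Sorgenfrey topology (generated by the intervals $[a,b)$), i.e. for every $t\in D$ there is $\delta>0$ with $[t,t+\delta)\subset D$. For $D\in\mathcal{D}$, $E\subset\mathbb{R}^n$ and $s\ge0$ let $$\mathcal{H}^s_{D,\infty}(E)=\inf\left\{\sum_{i=1}^\infty|E_i|^s: E\subset\bigcup_{i=1}^\infty E_i,\ |E_i|\in D\text{ for all }i\right\},\qquad \dim_H^D E=\inf\{s\ge0:\mathcal{H}^s_{D,\infty}(E)=0\}.$$ The universal restricted Hausdorff dimension is $\dim_U E=\sup\{\dim_H^D E: D\in\mathcal{D}\}$. *)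

theory Defs
  imports "HOL-Analysis.Analysis"
begin

definition nowhere_dense :: "'a::topological_space set \<Rightarrow> bool" where
  "nowhere_dense A \<longleftrightarrow> interior (closure A) = {}"

definition meager :: "'a::topological_space set \<Rightarrow> bool" where
  "meager A \<longleftrightarrow> (\<exists>N :: nat \<Rightarrow> 'a set. (\<forall>i. nowhere_dense (N i)) \<and> A = (\<Union>i. N i))"

definition comeager_in :: "'a::topological_space set \<Rightarrow> 'a set \<Rightarrow> bool" where
  "comeager_in E U \<longleftrightarrow> meager (U - E)"

definition sorgenfrey :: "real topology" where
  "sorgenfrey = topology_generated_by {{a..<b} | a b. True}"

lemma openin_sorgenfrey_iff:
  "openin sorgenfrey D \<longleftrightarrow> (\<forall>t\<in>D. \<exists>\<delta>>0. {t..<t + \<delta>} \<subseteq> D)"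
proof
  assume "openin sorgenfrey D"
  then have "generate_topology_on {{a..<b} | a b. True} D"
    by (simp add: sorgenfrey_def openin_topology_generated_by_iff)
  then show "\<forall>t\<in>D. \<exists>\<delta>>0. {t..<t + \<delta>} \<subseteq> D"
  proof induction
    case (Int A B)
    show ?case
    proof
      fix t assume "t \<in> A \<inter> B"
      then obtain d e where "d > 0" "{t..<t + d} \<subseteq> A" "e > 0" "{t..<t + e} \<subseteq> B"
        using Int by blast
      then have "min d e > 0" "{t..<t + min d e} \<subseteq> A \<inter> B"
        by (auto intro!: subsetD[of "{t..<t + d}" A] subsetD[of "{t..<t + e}" B])
      then show "\<exists>\<delta>>0. {t..<t + \<delta>} \<subseteq> A \<inter> B" by blast
    qed
  next
    case (UN K)
    then show ?case by blast
  next
    case (Basis S)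
    then obtain a b where S: "S = {a..<b}" by blast
    show ?case
    proof
      fix t assume "t \<in> S"
      then have "b - t > 0" "{t..<t + (b - t)} \<subseteq> S" by (auto simp: S)
      then show "\<exists>\<delta>>0. {t..<t + \<delta>} \<subseteq> S" by blast
    qed
  qed simp
next
  assume D: "\<forall>t\<in>D. \<exists>\<delta>>0. {t..<t + \<delta>} \<subseteq> D"
  show "openin sorgenfrey D"
  proof (subst openin_subopen, intro ballI)
    fix t assume "t \<in> D"
    then obtain d where "d > 0" "{t..<t + d} \<subseteq> D" using D by blast
    moreover have "openin sorgenfrey {t..<t + d}"
      unfolding sorgenfrey_def by (rule topology_generated_by_Basis) blast
    ultimately show "\<exists>T. openin sorgenfrey T \<and> t \<in> T \<and> T \<subseteq> D" by force
  qed
qed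

text \<open>Nonemptiness is explicit because \<open>Inf {}\<close> is an unspecified real number, whereas
  the infimum of the empty set is conventionally \<open>\<infinity>\<close>.\<close>

definition scale_sets :: "real set set" where
  "scale_sets = {D. D \<subseteq> {0<..} \<and> D \<noteq> {} \<and> Inf D = 0 \<and> openin sorgenfrey D}"

text \<open>Boundedness is explicit because \<open>diameter\<close> is real-valued and is not meaningful on
  unbounded sets, whose diameter is \<open>\<infinity>\<close> and hence never in \<open>D\<close>.  All diameters below are
  positive, so \<open>powr\<close> is the genuine power, also for \<open>s = 0\<close>.\<close>

definition restricted_hausdorff_content ::
    "real set \<Rightarrow> real \<Rightarrow> 'a::metric_space set \<Rightarrow> ennreal" where
  "restricted_hausdorff_content D s E =
     Inf {(\<Sum>i. ennreal (diameter (C i) powr s)) | C :: nat \<Rightarrow> 'a set.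
            E \<subseteq> (\<Union>i. C i) \<and> (\<forall>i. bounded (C i) \<and> diameter (C i) \<in> D)}"

definition restricted_hausdorff_dim :: "real set \<Rightarrow> 'a::metric_space set \<Rightarrow> ennreal" where
  "restricted_hausdorff_dim D E =
     Inf {ennreal s | s. s \<ge> 0 \<and> restricted_hausdorff_content D s E = 0}"

definition universal_dim :: "'a::metric_space set \<Rightarrow> ennreal" where
  "universal_dim E = (SUP D\<in>scale_sets. restricted_hausdorff_dim D E)"

end

theory Submission
  imports Defs
begin

text \<open>
  The upper bound is the usual one: for \<open>s\<close> above the dimension \<open>n\<close>, a bounded set is covered
  by about \<open>d\<^sup>-\<^sup>n\<close> balls of diameter exactly \<open>d\<close>, at a cost of order \<open>d powr (s - n)\<close>, and \<open>D\<close>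
  contains arbitrarily small \<open>d\<close> (\<open>content_eq_0_above_dimension\<close>).

  For the lower bound one set of scales suffices, up to discarding finitely many of them.
  Write \<open>U - E\<close> as a union of nowhere dense sets \<open>N k\<close> and build \<open>K\<close> as the intersection of a
  sequence of stages, each a finite union of compact sets with nonempty interior.
  Any ball contains of the order of \<open>d\<^sup>-\<^sup>n\<close> points that are \<open>4 * d\<close>-separated, hence at least
  \<open>d powr (- s)\<close> of them when \<open>s < n\<close> and \<open>d\<close> is small.  Close to each of these points there is a
  tiny ball missing \<open>N k\<close>.  So stage \<open>k + 1\<close> can be chosen to miss \<open>N k\<close> and to contain, inside
  every member of stage \<open>k\<close>, at least \<open>d k powr (- \<sigma> k)\<close> members at mutual distance at least
  \<open>2 * d k\<close>, with \<open>\<sigma> k\<close> tending to \<open>n\<close> (\<open>next_stage\<close>).  The allowed diameters are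
  those in the intervals \<open>[d k, 2 * d k)\<close>.

  Suppose that a cover by sets with such diameters has \<open>s\<close>-cost below
  \<open>1\<close>.  A covering set with diameter in \<open>[d k, 2 * d k)\<close> costs at least \<open>d k powr s\<close>, so there are
  fewer than \<open>d k powr (- s)\<close> of these, and each of them meets at most one of the children of a given
  member of stage \<open>k\<close>.  Some child is therefore missed by all of them
  (\<open>child_avoiding_cover\<close>).  Descending to such a child at every stage gives a point of
  \<open>K\<close> outside the cover (\<open>cover_of_fusion_ge_one\<close>).
\<close>

section \<open>Separated sets in Euclidean space\<close>

text \<open>The balls of radius \<open>\<delta> / 2\<close> around the points are disjoint and lie in one ball of radius
  \<open>r + \<delta> / 2\<close>, so their volumes add up to at most its volume.\<close>

lemma card_separated_le:
  fixes x :: "'a::euclidean_space"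
  assumes "finite P" "P \<subseteq> cball x r" "pairwise (\<lambda>p q. \<delta> \<le> dist p q) P" "\<delta> > 0" "r \<ge> 0"
  shows "real (card P) \<le> (1 + 2 * r / \<delta>) ^ DIM('a)"
proof -
  have disj: "disjoint_family_on (\<lambda>p. ball p (\<delta>/2)) P"
    unfolding disjoint_family_on_def
  proof (intro ballI impI, rule ccontr)
    fix p q assume pq: "p \<in> P" "q \<in> P" "p \<noteq> q" and "ball p (\<delta>/2) \<inter> ball q (\<delta>/2) \<noteq> {}"
    then obtain z where "dist p z < \<delta>/2" "dist q z < \<delta>/2" by auto
    then have "dist p q < \<delta>" using dist_triangle2[of p q z] by linarith
    with pairwiseD[OF assms(3) pq] show False by simp
  qed
  have sub: "(\<Union>p\<in>P. ball p (\<delta>/2)) \<subseteq> ball x (r + \<delta>/2)"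
  proof clarify
    fix p z assume "p \<in> P" "z \<in> ball p (\<delta>/2)"
    then have "dist x p \<le> r" "dist p z < \<delta>/2" using assms(2) by auto
    then show "z \<in> ball x (r + \<delta>/2)" using dist_triangle[of x z p] by simp
  qed
  have "real (card P) * (unit_ball_vol (real DIM('a)) * (\<delta>/2) ^ DIM('a))
      = (\<Sum>p\<in>P. measure lborel (ball p (\<delta>/2)))"
    using assms(4) by (simp add: content_ball)
  also have "\<dots> = measure lborel (\<Union>p\<in>P. ball p (\<delta>/2))"
    by (rule measure_finite_Union[symmetric])
       (use assms(1) disj emeasure_bounded_finite in \<open>auto simp: less_top[symmetric]\<close>)
  also have "\<dots> \<le> measure lborel (ball x (r + \<delta>/2))"
    by (rule measure_mono_fmeasurable[OF sub]) (auto simp: assms(1) intro!: fmeasurableI emeasure_bounded_finite)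
  also have "\<dots> = unit_ball_vol (real DIM('a)) * (r + \<delta>/2) ^ DIM('a)"
    using assms by (simp add: content_ball)
  finally have "real (card P) * (\<delta>/2) ^ DIM('a) \<le> (r + \<delta>/2) ^ DIM('a)"
    by (simp add: mult.left_commute)
  then have "real (card P) \<le> ((r + \<delta>/2) / (\<delta>/2)) ^ DIM('a)"
    unfolding power_divide[of "r + \<delta>/2"] using assms(4) by (simp add: pos_le_divide_eq del: power_divide)
  also have "(r + \<delta>/2) / (\<delta>/2) = 1 + 2 * r / \<delta>"
    using assms(4) by (simp add: field_simps)
  finally show ?thesis .
qed

text \<open>The cardinality bound lets one take a separated subset with as many points as possible; a
  point of \<open>S\<close> outside all the balls could be added to it.\<close>

lemma maximal_separated_subset:
  fixes S :: "'a::euclidean_space set"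
  assumes "bounded S" "\<delta> > 0"
  obtains P where "finite P" "P \<subseteq> S" "pairwise (\<lambda>p q. \<delta> \<le> dist p q) P"
    "S \<subseteq> (\<Union>p\<in>P. ball p \<delta>)"
proof -
  define Q where "Q P \<longleftrightarrow> finite P \<and> P \<subseteq> S \<and> pairwise (\<lambda>p q. \<delta> \<le> dist p q) P" for P
  obtain r where r: "r > 0" "S \<subseteq> cball 0 r"
    using assms(1) by (auto simp: bounded_pos subset_iff)
  have "card P \<le> nat \<lfloor>(1 + 2 * r / \<delta>) ^ DIM('a)\<rfloor>" if "Q P" for P
    using card_separated_le[of P 0 r \<delta>] that r assms(2) unfolding Q_def
    by (auto intro!: le_nat_floor)
  moreover have "Q {}" by (simp add: Q_def)
  ultimately obtain P where P: "Q P" and max: "\<And>P'. Q P' \<Longrightarrow> card P' \<le> card P"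
    using ex_has_greatest_nat[of Q "{}" card] by (metis less_Suc_eq_le)
  have "S \<subseteq> (\<Union>p\<in>P. ball p \<delta>)"
  proof (rule ccontr)
    assume "\<not> ?thesis"
    then obtain z where z: "z \<in> S" "\<And>p. p \<in> P \<Longrightarrow> \<delta> \<le> dist p z" by force
    then have "z \<notin> P" using assms(2) by force
    moreover have "Q (insert z P)"
      using P z unfolding Q_def by (auto simp: pairwise_insert dist_commute)
    ultimately show False using max[of "insert z P"] P by (simp add: Q_def)
  qed
  with P that show thesis by (auto simp: Q_def)
qed

lemma card_cover_ge:
  fixes x :: "'a::euclidean_space"
  assumes "finite P" "ball x r \<subseteq> (\<Union>p\<in>P. ball p \<delta>)" "\<delta> > 0" "r > 0"
  shows "(r / \<delta>) ^ DIM('a) \<le> real (card P)"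
proof -
  have "unit_ball_vol (real DIM('a)) * r ^ DIM('a) = measure lborel (ball x r)"
    using assms by (simp add: content_ball)
  also have "\<dots> \<le> measure lborel (\<Union>p\<in>P. ball p \<delta>)"
    by (rule measure_mono_fmeasurable[OF assms(2)]) (auto simp: assms(1) intro!: open_UN fmeasurableI emeasure_bounded_finite)
  also have "\<dots> \<le> (\<Sum>p\<in>P. measure lborel (ball p \<delta>))"
    by (rule measure_UNION_le) (auto simp: assms(1))
  also have "\<dots> = unit_ball_vol (real DIM('a)) * (real (card P) * \<delta> ^ DIM('a))"
    using assms(3) by (simp add: content_ball)
  finally show ?thesis
    using assms(3) by (simp add: power_divide pos_divide_le_eq)
qed

section \<open>Refining a stage\<close>

text \<open>The factor \<open>2\<close> makes a set of diameter less than \<open>2 * d\<close> meet at most one member, while the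
  cardinality is so large that as many sets of diameter at least \<open>d\<close> have \<open>s\<close>-cost at least \<open>1\<close>.\<close>

definition rich_at_scale :: "real \<Rightarrow> real \<Rightarrow> 'a::metric_space set set \<Rightarrow> bool" where
  "rich_at_scale d s \<C> \<longleftrightarrow> finite \<C> \<and> pairwise (\<lambda>C C'. \<forall>x\<in>C. \<forall>y\<in>C'. 2 * d \<le> dist x y) \<C>
     \<and> 1 \<le> real (card \<C>) * d powr s"

text \<open>The centres come from a \<open>4 * d\<close>-separated subset of a ball inside \<open>B\<close>.  Moving each by less
  than \<open>d\<close> into the complement of \<open>closure N\<close> keeps the resulting sets at distance \<open>2 * d\<close>.  Their number
  is at least a constant times \<open>d powr (- DIM('a))\<close>, which exceeds \<open>d powr (- s)\<close> for all small \<open>d\<close>.\<close>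

lemma separated_children:
  fixes B N :: "'a::euclidean_space set" and s :: real
  assumes "interior B \<noteq> {}" "nowhere_dense N" "s < DIM('a)"
  shows "\<forall>\<^sub>F d in at_right 0. \<exists>\<C>. (\<forall>C\<in>\<C>. compact C \<and> interior C \<noteq> {} \<and> C \<subseteq> B \<and> C \<inter> N = {})
    \<and> rich_at_scale d s \<C>"
proof -
  obtain x r where r: "r > 0" "ball x r \<subseteq> interior B"
    using assms(1) by (meson ex_in_conv open_contains_ball open_interior)
  have "((\<lambda>d::real. d powr (DIM('a) - s)) \<longlongrightarrow> 0) (at_right 0)"
    using assms(3) by (auto intro!: tendsto_eq_intros simp: eventually_at_filter)
  moreover have "(r / 4) ^ DIM('a) > 0" using r by simp
  ultimately have "\<forall>\<^sub>F d in at_right 0. d powr (DIM('a) - s) < (r / 4) ^ DIM('a)"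
    by (rule order_tendstoD)
  moreover have "\<forall>\<^sub>F d::real in at_right 0. d > 0" by (simp add: eventually_at_filter)
  ultimately show ?thesis
  proof eventually_elim
    case (elim d)
    obtain P where P: "finite P" "P \<subseteq> ball x r" "pairwise (\<lambda>p q. 4 * d \<le> dist p q) P"
      "ball x r \<subseteq> (\<Union>p\<in>P. ball p (4 * d))"
      using maximal_separated_subset[of "ball x r" "4 * d"] elim by auto
    have "\<exists>q e. e > 0 \<and> cball q e \<subseteq> ball p d \<inter> ball x r - closure N" if "p \<in> P" for p
    proof -
      let ?O = "ball p d \<inter> ball x r"
      have "open ?O" "p \<in> ?O" using that P elim by auto
      then have "\<not> ?O \<subseteq> closure N"
        using assms(2) interior_maximal[of ?O "closure N"] unfolding nowhere_dense_def by fast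
      then obtain q where "q \<in> ?O - closure N" by blast
      moreover have "open (?O - closure N)" by (intro open_Diff) auto
      ultimately show ?thesis by (meson open_contains_cball)
    qed
    then obtain q e where qe: "\<And>p. p \<in> P \<Longrightarrow> e p > 0 \<and> cball (q p) (e p) \<subseteq> ball p d \<inter> ball x r - closure N"
      by metis
    define f where "f p = cball (q p) (e p)" for p
    have far: "2 * d \<le> dist y z" if "p \<in> P" "p' \<in> P" "p \<noteq> p'" "y \<in> f p" "z \<in> f p'" for p p' y z
    proof -
      have "dist p y < d" "dist p' z < d" using that qe unfolding f_def by (meson Diff_iff IntE mem_ball subsetD)+
      moreover have "4 * d \<le> dist p p'" using that P(3) by (auto simp: pairwise_def)
      moreover have "dist p p' \<le> dist p y + dist y z + dist p' z"
        using dist_triangle[of p p' y] dist_triangle2[of y p' z] by linarith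
      ultimately show ?thesis by linarith
    qed
    have ne: "q p \<in> f p" if "p \<in> P" for p using qe[OF that] by (simp add: f_def)
    have "inj_on f P"
    proof (rule inj_onI, rule ccontr)
      fix p p' assume "p \<in> P" "p' \<in> P" "f p = f p'" "p \<noteq> p'"
      with far[of p p' "q p" "q p"] ne[of p] elim show False by simp
    qed
    then have card: "card (f ` P) = card P" by (rule card_image)
    have "1 \<le> real (card P) * d powr s"
    proof -
      have "d powr (- s) = d powr (DIM('a) - s) / d ^ DIM('a)"
        using elim by (simp add: powr_diff powr_realpow powr_minus field_simps)
      also have "\<dots> \<le> (r / 4) ^ DIM('a) / d ^ DIM('a)"
        using elim by (intro divide_right_mono) auto
      also have "\<dots> = (r / (4 * d)) ^ DIM('a)" by (simp add: power_divide power_mult_distrib)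
      also have "\<dots> \<le> real (card P)" using card_cover_ge[OF P(1,4)] elim r by simp
      finally show ?thesis using elim by (simp add: powr_minus field_simps)
    qed
    moreover have "compact C \<and> interior C \<noteq> {} \<and> C \<subseteq> B \<and> C \<inter> N = {}" if C: "C \<in> f ` P" for C
    proof -
      obtain p where p: "p \<in> P" "C = cball (q p) (e p)" using C by (auto simp: f_def)
      have "C \<subseteq> B" using p qe[of p] r(2) interior_subset[of B] by blast
      moreover have "C \<inter> N = {}" using p qe[of p] closure_subset[of N] by blast
      ultimately show ?thesis using p qe[of p] by (simp add: interior_cball)
    qed
    moreover have "pairwise (\<lambda>C C'. \<forall>x\<in>C. \<forall>y\<in>C'. 2 * d \<le> dist x y) (f ` P)"
      unfolding pairwise_def using far by auto
    ultimately show ?case using P(1) card by (intro exI[of _ "f ` P"]) (auto simp: rich_at_scale_def)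
  qed
qed

text \<open>A stage is finite and every sufficiently small scale suits each of its members, so one scale
  \<open>d\<close> serves them all.\<close>

lemma next_stage:
  fixes \<B> :: "'a::euclidean_space set set" and s :: real
  assumes "finite \<B>" "\<And>B. B \<in> \<B> \<Longrightarrow> interior B \<noteq> {}" "nowhere_dense N" "s < DIM('a)" "\<epsilon> > 0"
  obtains \<B>' d where "finite \<B>'" "0 < d" "d < \<epsilon>"
    "\<And>C. C \<in> \<B>' \<Longrightarrow> compact C \<and> interior C \<noteq> {} \<and> C \<inter> N = {}"
    "\<And>B. B \<in> \<B> \<Longrightarrow> \<exists>\<C>\<subseteq>\<B>'. \<Union>\<C> \<subseteq> B \<and> rich_at_scale d s \<C>"
proof -
  define good where "good d B \<C> \<longleftrightarrow> (\<forall>C\<in>\<C>. compact C \<and> interior C \<noteq> {} \<and> C \<subseteq> B \<and> C \<inter> N = {})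
    \<and> rich_at_scale d s \<C>" for d B \<C>
  have "\<forall>\<^sub>F d in at_right 0. \<forall>B\<in>\<B>. \<exists>\<C>. good d B \<C>"
    unfolding good_def using assms by (intro eventually_ball_finite ballI separated_children) auto
  moreover have "\<forall>\<^sub>F d in at_right 0. d \<in> {0<..<\<epsilon>}"
    using assms(5) by (rule eventually_at_right_real)
  ultimately have "\<forall>\<^sub>F d in at_right 0. d \<in> {0<..<\<epsilon>} \<and> (\<forall>B\<in>\<B>. \<exists>\<C>. good d B \<C>)"
    by (rule eventually_conj[rotated])
  then obtain d where d: "d \<in> {0<..<\<epsilon>}" and "\<forall>B\<in>\<B>. \<exists>\<C>. good d B \<C>"
    using eventually_happens'[OF trivial_limit_at_right_real] by blast
  then obtain ch where ch: "\<And>B. B \<in> \<B> \<Longrightarrow> good d B (ch B)"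
    by metis
  show thesis
  proof (rule that[of "\<Union>(ch ` \<B>)" d])
    show "\<exists>\<C>\<subseteq>\<Union>(ch ` \<B>). \<Union>\<C> \<subseteq> B \<and> rich_at_scale d s \<C>" if B: "B \<in> \<B>" for B
      using ch[OF B] B unfolding good_def by (intro exI[of _ "ch B"]) auto
    show "finite (\<Union>(ch ` \<B>))"
      using ch assms(1) unfolding good_def rich_at_scale_def by auto
    show "compact C \<and> interior C \<noteq> {} \<and> C \<inter> N = {}" if "C \<in> \<Union>(ch ` \<B>)" for C
      using ch that unfolding good_def by auto
  qed (use d in auto)
qed

section \<open>Covers at the chosen scales are expensive\<close>

text \<open>If every member of \<open>\<C>\<close> met one of the sets \<open>C i\<close> at scale \<open>d\<close>, different members would need
  different \<open>i\<close>, because of the separation; the \<open>card \<C>\<close> sets so found would already cost \<open>1\<close>.\<close>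

lemma child_avoiding_cover:
  fixes C :: "nat \<Rightarrow> 'a::metric_space set"
  assumes sum: "(\<Sum>i. ennreal (diameter (C i) powr s)) < 1"
    and bdd: "\<And>i. bounded (C i)"
    and rich: "rich_at_scale d s \<C>"
    and pos: "d > 0" "s \<ge> 0"
  shows "\<exists>A\<in>\<C>. \<forall>i. diameter (C i) \<in> {d..<2*d} \<longrightarrow> A \<inter> C i = {}"
proof (rule ccontr)
  note \<C> = rich[unfolded rich_at_scale_def]
  assume "\<not> ?thesis"
  then obtain \<iota> where \<iota>: "\<And>A. A \<in> \<C> \<Longrightarrow> diameter (C (\<iota> A)) \<in> {d..<2*d} \<and> A \<inter> C (\<iota> A) \<noteq> {}"
    by metis
  have inj: "inj_on \<iota> \<C>"
  proof (rule inj_onI, rule ccontr)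
    fix A A' assume A: "A \<in> \<C>" "A' \<in> \<C>" "\<iota> A = \<iota> A'" "A \<noteq> A'"
    obtain x y where xy: "x \<in> A" "x \<in> C (\<iota> A)" "y \<in> A'" "y \<in> C (\<iota> A)"
      using \<iota>[OF A(1)] \<iota>[OF A(2)] A(3) by auto
    then have "2 * d \<le> dist x y" using \<C> A by (auto simp: pairwise_def)
    also have "\<dots> \<le> diameter (C (\<iota> A))" using xy bdd by (intro diameter_bounded_bound) auto
    also have "\<dots> < 2 * d" using \<iota>[OF A(1)] by auto
    finally show False by simp
  qed
  have "1 \<le> ennreal (real (card \<C>) * d powr s)" using \<C> by simp
  also have "\<dots> = (\<Sum>i\<in>\<iota> ` \<C>. ennreal (d powr s))"
    by (simp add: card_image[OF inj] ennreal_mult ennreal_of_nat_eq_real_of_nat)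
  also have "\<dots> \<le> (\<Sum>i\<in>\<iota> ` \<C>. ennreal (diameter (C i) powr s))"
    using \<iota> pos by (intro sum_mono ennreal_leI powr_mono2) auto
  also have "\<dots> \<le> (\<Sum>i. ennreal (diameter (C i) powr s))"
    using \<C> by (intro sum_le_suminf) auto
  finally show False using sum by simp
qed


lemma rich_at_scale_mono:
  assumes "rich_at_scale d s \<C>" "t \<le> s" "0 < d" "d \<le> 1"
  shows "rich_at_scale d t \<C>"
proof -
  have "real (card \<C>) * d powr s \<le> real (card \<C>) * d powr t"
    using assms by (intro mult_left_mono powr_mono') auto
  with assms(1) show ?thesis by (auto simp: rich_at_scale_def)
qed

text \<open>From a cheap cover one gets a decreasing sequence, one member from each stage, whose common
  point lies in no \<open>C i\<close>.  Up to stage \<open>m\<close> the members are chosen arbitrarily, since only the scales from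
  \<open>m\<close> on occur as diameters; this is what allows an exponent \<open>s\<close> that exceeds the first few
  \<open>\<sigma> k\<close>.\<close>

lemma cover_of_fusion_ge_one:
  fixes \<B> :: "nat \<Rightarrow> 'a::heine_borel set set" and C :: "nat \<Rightarrow> 'a set"
  assumes "\<B> 0 \<noteq> {}"
    and cpt: "\<And>k B. B \<in> \<B> k \<Longrightarrow> compact B \<and> B \<noteq> {}"
    and children: "\<And>k B. B \<in> \<B> k \<Longrightarrow> \<exists>\<C>\<subseteq>\<B> (Suc k). \<Union>\<C> \<subseteq> B \<and> rich_at_scale (d k) (\<sigma> k) \<C>"
    and d: "\<And>k. 0 < d k \<and> d k \<le> 1"
    and s: "s \<ge> 0" "\<And>k. k \<ge> m \<Longrightarrow> s \<le> \<sigma> k"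
    and cover: "(\<Inter>k. \<Union>(\<B> k)) \<subseteq> (\<Union>i. C i)"
    and bdd: "\<And>i. bounded (C i)"
    and diam: "\<And>i. diameter (C i) \<in> (\<Union>k\<in>{m..}. {d k..<2 * d k})"
  shows "1 \<le> (\<Sum>i. ennreal (diameter (C i) powr s))"
proof (rule ccontr)
  assume "\<not> ?thesis"
  then have sum: "(\<Sum>i. ennreal (diameter (C i) powr s)) < 1" by simp
  have child: "\<exists>A. A \<in> \<B> (Suc k) \<and> A \<subseteq> B \<and> (k \<ge> m \<longrightarrow> (\<forall>i. diameter (C i) \<in> {d k..<2 * d k} \<longrightarrow> A \<inter> C i = {}))"
    if B: "B \<in> \<B> k" for k B
  proof -
    obtain \<C> where \<C>: "\<C> \<subseteq> \<B> (Suc k)" "\<Union>\<C> \<subseteq> B" "rich_at_scale (d k) (\<sigma> k) \<C>"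
      using children[OF B] by meson
    show ?thesis
    proof (cases "k \<ge> m")
      case True
      then have "rich_at_scale (d k) s \<C>" using rich_at_scale_mono[OF \<C>(3)] s(2) d by blast
      then obtain A where "A \<in> \<C>" "\<forall>i. diameter (C i) \<in> {d k..<2 * d k} \<longrightarrow> A \<inter> C i = {}"
        using child_avoiding_cover[OF sum bdd] d s(1) by meson
      with \<C>(1,2) show ?thesis by (intro exI[of _ A]) auto
    next
      case False
      have "\<C> \<noteq> {}" using \<C>(3) by (auto simp: rich_at_scale_def)
      then obtain A where "A \<in> \<C>" by blast
      with \<C>(1,2) False show ?thesis by (intro exI[of _ A]) auto
    qed
  qed
  have "\<exists>F. \<forall>k. F k \<in> \<B> k \<and> (F (Suc k) \<subseteq> F k
      \<and> (k \<ge> m \<longrightarrow> (\<forall>i. diameter (C i) \<in> {d k..<2 * d k} \<longrightarrow> F (Suc k) \<inter> C i = {})))"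
  proof (rule dependent_nat_choice)
    show "\<exists>B. B \<in> \<B> 0" using assms(1) by blast
  qed (rule child)
  then obtain F where F: "\<And>k. F k \<in> \<B> k" "\<And>k. F (Suc k) \<subseteq> F k"
    and avoid: "\<And>k i. k \<ge> m \<Longrightarrow> diameter (C i) \<in> {d k..<2 * d k} \<Longrightarrow> F (Suc k) \<inter> C i = {}"
    by blast
  have "\<Inter>(range F) \<noteq> {}"
  proof (rule compact_nest)
    show "F k \<subseteq> F j" if "j \<le> k" for j k using lift_Suc_antimono_le[of F] F(2) that by blast
  qed (use cpt[OF F(1)] in auto)
  then obtain x where x: "\<And>k. x \<in> F k" by blast
  then have "x \<in> (\<Inter>k. \<Union>(\<B> k))" using F(1) by blast
  then obtain i where i: "x \<in> C i" using cover by blast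
  obtain k where "k \<ge> m" "diameter (C i) \<in> {d k..<2 * d k}" using diam[of i] by blast
  with avoid x i show False by blast
qed

section \<open>The dimension of the space as an upper bound\<close>

lemma scale_sets_arbitrarily_small:
  assumes "D \<in> scale_sets" "\<eta> > 0"
  obtains d where "d \<in> D" "0 < d" "d < \<eta>"
proof -
  have "D \<noteq> {}" "Inf D < \<eta>" "D \<subseteq> {0<..}" using assms by (auto simp: scale_sets_def)
  with cInf_lessD[of D \<eta>] that show thesis by auto
qed

text \<open>A cover is an infinite sequence in which every diameter is positive, so after the finitely
  many balls that do the covering it is continued with balls of rapidly decreasing cost.\<close>

lemma content_eq_0_above_dimension:
  fixes K :: "'a::euclidean_space set"
  assumes D: "D \<in> scale_sets" and "bounded K" and s: "s > real DIM('a)"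
  shows "restricted_hausdorff_content D s K = 0"
proof -
  have "restricted_hausdorff_content D s K \<le> 0 + ennreal e" if e: "e > 0" for e
  proof -
    obtain r where r: "r > 0" "K \<subseteq> cball 0 r"
      using assms(2) by (auto simp: bounded_pos subset_iff)
    define a where "a = (1 + 4 * r) ^ DIM('a)"
    have "((\<lambda>d::real. a * d powr (s - DIM('a))) \<longlongrightarrow> 0) (at_right 0)"
      using s by (auto intro!: tendsto_eq_intros simp: eventually_at_filter)
    then have "\<forall>\<^sub>F d in at_right 0. a * d powr (s - DIM('a)) < e / 2"
      by (rule order_tendstoD) (use e in auto)
    then obtain b where b: "b > 0" "\<And>d. 0 < d \<Longrightarrow> d < b \<Longrightarrow> a * d powr (s - DIM('a)) < e / 2"
      by (auto simp: eventually_at_right_field)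
    obtain d where d: "d \<in> D" "0 < d" "d < min b 1"
      using scale_sets_arbitrarily_small[OF D, of "min b 1"] b by auto
    obtain P where P: "finite P" "P \<subseteq> K" "pairwise (\<lambda>p q. d / 2 \<le> dist p q) P"
      "K \<subseteq> (\<Union>p\<in>P. ball p (d / 2))"
      using maximal_separated_subset[OF assms(2), of "d / 2"] d by auto
    have "real (card P) \<le> (1 + 2 * r / (d / 2)) ^ DIM('a)"
      by (rule card_separated_le[of P 0]) (use P r d in auto)
    also have "\<dots> \<le> ((1 + 4 * r) / d) ^ DIM('a)"
      using d r by (intro power_mono) (auto simp: field_simps)
    finally have "real (card P) * d powr s \<le> a / d ^ DIM('a) * d powr s"
      by (intro mult_right_mono) (auto simp: a_def power_divide)
    also have "\<dots> = a * d powr (s - DIM('a))"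
      using d by (simp add: powr_diff powr_realpow)
    also have "\<dots> < e / 2" using b d by simp
    finally have cost: "real (card P) * d powr s \<le> e / 2" by simp
    \<comment> \<open>The tail of the cover has total cost at most \<open>e / 2\<close>.\<close>
    have "\<exists>t. t \<in> D \<and> 0 < t \<and> t powr s \<le> e / 2 * (1/2) ^ Suc i" for i
    proof -
      let ?c = "e / 2 * (1/2) ^ Suc i"
      have "?c powr (1 / s) > 0" using e by simp
      from scale_sets_arbitrarily_small[OF D this]
      obtain t where t: "t \<in> D" "0 < t" "t < ?c powr (1 / s)" by blast
      have "t powr s \<le> (?c powr (1 / s)) powr s"
        using t s by (intro powr_mono2) auto
      also have "\<dots> = ?c" using s e by (simp add: powr_powr)
      finally show ?thesis using t by blast
    qed
    then obtain t where t: "\<And>i. t i \<in> D \<and> 0 < t i \<and> t i powr s \<le> e / 2 * (1/2) ^ Suc i"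
      by metis
    obtain h where h: "bij_betw h {0..<card P} P" using ex_bij_betw_nat_finite[OF P(1)] by blast
    define C where "C i = (if i < card P then cball (h i) (d / 2) else cball 0 (t i / 2))" for i
    have diamC: "diameter (C i) = (if i < card P then d else t i)" for i
      using d t[of i] by (auto simp: C_def)
    have "K \<subseteq> (\<Union>i. C i)"
    proof
      fix x assume "x \<in> K"
      then obtain p where p: "p \<in> P" "x \<in> ball p (d / 2)" using P(4) by auto
      then obtain i where "i < card P" "h i = p"
        using bij_betw_imp_surj_on[OF h] by (metis atLeastLessThan_iff imageE)
      then have "x \<in> C i" using p by (simp add: C_def)
      then show "x \<in> (\<Union>i. C i)" by blast
    qed
    moreover have "\<forall>i. bounded (C i) \<and> diameter (C i) \<in> D"
      using d t by (auto simp: diamC) (simp add: C_def)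
    ultimately have "restricted_hausdorff_content D s K \<le> (\<Sum>i. ennreal (diameter (C i) powr s))"
      unfolding restricted_hausdorff_content_def by (intro Inf_lower) blast
    also have "\<dots> \<le> (\<Sum>i. ennreal ((if i \<in> {..<card P} then d powr s else 0) + e / 2 * (1/2) ^ Suc i))"
    proof (intro suminf_le ennreal_leI)
      fix i
      show "diameter (C i) powr s \<le> (if i \<in> {..<card P} then d powr s else 0) + e / 2 * (1/2) ^ Suc i"
        using t[of i] e by (auto simp: diamC)
    qed auto
    also have "\<dots> = ennreal ((\<Sum>i<card P. d powr s) + e / 2 * 1)"
      by (intro suminf_ennreal_eq sums_add sums_If_finite_set sums_mult power_half_series)
         (use e in auto)
    also have "\<dots> \<le> ennreal e" using cost by (intro ennreal_leI) simp
    finally show ?thesis by simp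
  qed
  then have "restricted_hausdorff_content D s K \<le> 0" by (rule ennreal_le_epsilon)
  then show ?thesis by simp
qed

lemma universal_dim_le_DIM:
  fixes K :: "'a::euclidean_space set"
  assumes "bounded K"
  shows "universal_dim K \<le> of_nat DIM('a)"
  unfolding universal_dim_def
proof (rule SUP_least)
  fix D assume D: "D \<in> scale_sets"
  have "restricted_hausdorff_dim D K \<le> ennreal (real DIM('a)) + ennreal e" if "e > 0" for e
  proof -
    have "restricted_hausdorff_dim D K \<le> ennreal (real DIM('a) + e)"
      unfolding restricted_hausdorff_dim_def
      using content_eq_0_above_dimension[OF D assms, of "real DIM('a) + e"] that
      by (intro Inf_lower CollectI exI[of _ "real DIM('a) + e"]) auto
    with that show ?thesis by simp
  qed
  then show "restricted_hausdorff_dim D K \<le> of_nat DIM('a)"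
    unfolding ennreal_of_nat_eq_real_of_nat by (rule ennreal_le_epsilon)
qed

section \<open>A compact set of full universal dimension\<close>

lemma union_of_scales_in_scale_sets:
  assumes "\<And>k. 0 < d k \<and> d k < 1 / Suc k"
  shows "(\<Union>k\<in>{m..}. {d k..<2 * d k}) \<in> scale_sets"
proof -
  let ?D = "\<Union>k\<in>{m..}. {d k..<2 * d k}"
  have mem: "d k \<in> ?D" if "k \<ge> m" for k using assms[of k] that by force
  have pos: "?D \<subseteq> {0<..}" using assms by (auto intro: less_le_trans)
  have "Inf ?D = 0"
  proof (rule antisym)
    show "0 \<le> Inf ?D" using mem[of m] pos by (intro cInf_greatest) force+
    show "Inf ?D \<le> 0"
    proof (rule field_le_epsilon)
      fix e :: real assume "e > 0"
      then obtain k where k: "1 / Suc k < e" using nat_approx_posE by blast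
      have "Inf ?D \<le> d (max m k)"
        using mem[of "max m k"] pos by (intro cInf_lower bdd_belowI[of _ 0]) force+
      also have "\<dots> \<le> 1 / Suc (max m k)" using assms by (intro less_imp_le) blast
      also have "\<dots> \<le> 1 / Suc k" by (intro divide_left_mono) auto
      finally show "Inf ?D \<le> 0 + e" using k by simp
    qed
  qed
  moreover have "openin sorgenfrey ?D"
    unfolding openin_sorgenfrey_iff
  proof
    fix t assume "t \<in> ?D"
    then obtain k where k: "k \<ge> m" "d k \<le> t" "t < 2 * d k" by auto
    then have "{t..<t + (2 * d k - t)} \<subseteq> ?D" by force
    with k show "\<exists>\<delta>>0. {t..<t + \<delta>} \<subseteq> ?D" by (intro exI[of _ "2 * d k - t"]) simp
  qed
  ultimately show ?thesis using pos mem[of m] unfolding scale_sets_def by blast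
qed

text \<open>The exponents \<open>\<sigma> k\<close> increase to the dimension, so that a single \<open>K\<close> works for every \<open>s\<close>
  below the dimension; only the number \<open>m\<close> of discarded scales depends on \<open>s\<close>.\<close>

lemma comeager_contains_compact_universal_dim:
  fixes E U :: "'a::euclidean_space set"
  assumes "open U" and "U \<noteq> {}" and "comeager_in E U"
  shows "\<exists>K. compact K \<and> K \<subseteq> E \<and> universal_dim K = of_nat DIM('a)"
proof -
  obtain N :: "nat \<Rightarrow> 'a set" where N: "\<And>k. nowhere_dense (N k)" "U - E = (\<Union>k. N k)"
    using assms(3) by (auto simp: comeager_in_def meager_def)
  define \<sigma> where "\<sigma> k = real DIM('a) - 1 / Suc k" for k
  define stage where "stage \<B> \<longleftrightarrow> finite \<B> \<and> \<B> \<noteq> {} \<and> (\<forall>B\<in>\<B>. compact B \<and> interior B \<noteq> {})"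
    for \<B> :: "'a set set"
  define refines where "refines k \<B> \<B>' d \<longleftrightarrow> 0 < d \<and> d < 1 / Suc k \<and> (\<forall>B\<in>\<B>'. B \<inter> N k = {})
    \<and> (\<forall>B\<in>\<B>. \<exists>\<C>\<subseteq>\<B>'. \<Union>\<C> \<subseteq> B \<and> rich_at_scale d (\<sigma> k) \<C>)" for k \<B> \<B>' d
  obtain x r where x: "r > 0" "cball x r \<subseteq> U"
    using assms(1,2) by (meson ex_in_conv open_contains_cball)
  \<comment> \<open>The first stage lies in \<open>U\<close>, and so does \<open>K\<close>.\<close>
  have "\<exists>\<B>. \<B> 0 = {cball x r} \<and> (\<forall>k. stage (\<B> k) \<and> (\<exists>d. refines k (\<B> k) (\<B> (Suc k)) d))"
  proof -
    have start: "stage {cball x r}" using x by (auto simp: stage_def interior_cball)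
    have step: "\<exists>\<B>'. stage \<B>' \<and> (\<exists>d. refines k \<B> \<B>' d)" if st: "stage \<B>" for k \<B>
    proof -
      obtain \<B>' d where *: "finite \<B>'" "0 < d" "d < 1 / Suc k"
        "\<And>C. C \<in> \<B>' \<Longrightarrow> compact C \<and> interior C \<noteq> {} \<and> C \<inter> N k = {}"
        "\<And>B. B \<in> \<B> \<Longrightarrow> \<exists>\<C>\<subseteq>\<B>'. \<Union>\<C> \<subseteq> B \<and> rich_at_scale d (\<sigma> k) \<C>"
        by (rule next_stage[of \<B> "N k" "\<sigma> k" "1 / Suc k"]) (use st N(1) in \<open>auto simp: stage_def \<sigma>_def\<close>)
      obtain B where "B \<in> \<B>" using st by (auto simp: stage_def)
      then obtain \<C> where "\<C> \<subseteq> \<B>'" "rich_at_scale d (\<sigma> k) \<C>" using *(5) by blast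
      then have "\<B>' \<noteq> {}" by (auto simp: rich_at_scale_def)
      with * have "stage \<B>'" "refines k \<B> \<B>' d" unfolding stage_def refines_def by blast+
      then show ?thesis by blast
    qed
    have "\<exists>\<B>. \<forall>k. (stage (\<B> k) \<and> (k = 0 \<longrightarrow> \<B> k = {cball x r})) \<and> (\<exists>d. refines k (\<B> k) (\<B> (Suc k)) d)"
      by (rule dependent_nat_choice) (use start step in auto)
    then show ?thesis by blast
  qed
  then obtain \<B> d where B0: "\<B> 0 = {cball x r}" and st: "\<And>k. stage (\<B> k)"
    and ref: "\<And>k. refines k (\<B> k) (\<B> (Suc k)) (d k)" by metis
  define K where "K = (\<Inter>k. \<Union>(\<B> k))"
  have "compact K"
    unfolding K_def using st by (intro compact_Inter) (auto simp: stage_def)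
  have d: "0 < d k \<and> d k < 1 / Suc k" for k using ref[of k] by (simp add: refines_def)
  have "K \<subseteq> E"
  proof
    fix y assume y: "y \<in> K"
    then have "y \<in> \<Union>(\<B> 0)" by (auto simp: K_def)
    then have "y \<in> U" using B0 x by auto
    moreover have "y \<notin> N k" for k
    proof -
      obtain B where "B \<in> \<B> (Suc k)" "y \<in> B" using y by (auto simp: K_def)
      with ref[of k] show ?thesis by (auto simp: refines_def)
    qed
    ultimately show "y \<in> E" using N(2) by blast
  qed
  have lower: "ennreal s \<le> universal_dim K" if s: "0 \<le> s" "s < real DIM('a)" for s
  proof -
    obtain m where m: "1 / Suc m < real DIM('a) - s" using s(2) nat_approx_posE[of "real DIM('a) - s"] by auto
    let ?D = "\<Union>k\<in>{m..}. {d k..<2 * d k}"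
    \<comment> \<open>For \<open>t < s\<close> the exponents \<open>\<sigma> k\<close> with \<open>k \<ge> m\<close> all exceed \<open>t\<close>, so the \<open>t\<close>-content of \<open>K\<close> is at least \<open>1\<close>.\<close>
    have "s \<le> t" if t: "0 \<le> t" "restricted_hausdorff_content ?D t K = 0" for t
    proof (rule ccontr)
      assume "\<not> s \<le> t"
      have \<sigma>: "t \<le> \<sigma> k" if "k \<ge> m" for k
      proof -
        have "1 / real (Suc k) \<le> 1 / Suc m" using that by (intro divide_left_mono) auto
        with m \<open>\<not> s \<le> t\<close> show ?thesis by (simp add: \<sigma>_def)
      qed
      have le1: "0 < d k \<and> d k \<le> 1" for k
        using d[of k] order_trans[of "d k" "1 / Suc k" 1] by simp
      have "1 \<le> restricted_hausdorff_content ?D t K"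
        unfolding restricted_hausdorff_content_def
      proof (rule Inf_greatest, clarify)
        fix C :: "nat \<Rightarrow> 'a set"
        assume C: "K \<subseteq> (\<Union>i. C i)" "\<forall>i. bounded (C i) \<and> diameter (C i) \<in> ?D"
        show "1 \<le> (\<Sum>i. ennreal (diameter (C i) powr t))"
        proof (rule cover_of_fusion_ge_one[of \<B> d \<sigma> t m C])
          show "compact B \<and> B \<noteq> {}" if "B \<in> \<B> k" for k B
            using st[of k] that unfolding stage_def by (metis interior_empty)
          show "\<exists>\<C>\<subseteq>\<B> (Suc k). \<Union>\<C> \<subseteq> B \<and> rich_at_scale (d k) (\<sigma> k) \<C>" if "B \<in> \<B> k" for k B
            using ref[of k] that by (simp add: refines_def)
        qed (use B0 le1 t(1) \<sigma> C in \<open>auto simp: K_def\<close>)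
      qed
      with t(2) show False by simp
    qed
    then have "ennreal s \<le> restricted_hausdorff_dim ?D K"
      unfolding restricted_hausdorff_dim_def by (intro Inf_greatest) (auto intro!: ennreal_leI)
    also have "\<dots> \<le> universal_dim K"
      unfolding universal_dim_def using d by (intro SUP_upper union_of_scales_in_scale_sets) auto
    finally show ?thesis .
  qed
  have "of_nat DIM('a) \<le> universal_dim K"
  proof (rule dense_le)
    fix y :: ennreal assume y: "y < of_nat DIM('a)"
    then obtain s where s: "y = ennreal s" "s \<ge> 0" by (cases y) auto
    with y have "s < real DIM('a)" by (simp add: ennreal_of_nat_eq_real_of_nat ennreal_less_iff)
    with lower s show "y \<le> universal_dim K" by simp
  qed
  moreover have "universal_dim K \<le> of_nat DIM('a)"
    using \<open>compact K\<close> by (intro universal_dim_le_DIM compact_imp_bounded)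
  ultimately show ?thesis using \<open>compact K\<close> \<open>K \<subseteq> E\<close> by (intro exI[of _ K]) auto
qed

theorem theorem4p9:
  fixes E U :: "(real ^ 'n) set"
  assumes "open U" and "U \<noteq> {}" and "comeager_in E U"
  shows "\<exists>K. compact K \<and> K \<subseteq> E \<and> universal_dim K = of_nat CARD('n)"
  using comeager_contains_compact_universal_dim[OF assms] by simp

end
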